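(* Let $\bar u\in U_{\mathrm{ad}}$ be a solution of the problem $$\min_{u\in U_{\mathrm{ad}}}\ \tfrac12\|Ku-z\|_Y^2+\alpha G(u)\qquad (P)$$ with corresponding state $\bar y:=K\bar u$, and assume that $\bar u$ satisfies Assumption REG with exponent $\kappa>0$. For $\gamma>0$ let $u_\gamma$ be the solution of $$\min_{u\in U_{\mathrm{ad}}}\ \tfrac12\|Ku-z\|_Y^2+\alpha G(u)+\tfrac{\gamma}{2}\|u\|_{L^2(\Omega)}^2\qquad (P_\gamma)$$ with corresponding state $y_\gamma:=Ku_\gamma$. Then there exists a constant $c>0$ (independent of $\gamma$) such that for all $\gamma>0$ $$\frac1\gamma\|y_\gamma-\bar y\|_Y^2+\frac1\gamma\|u_\gamma-\bar u\|_{L^1(\Omega)}^{1+\frac1\kappa}+\|u_\gamma-\bar u\|_{L^2(\Omega)}^2\le c\,\gamma^\kappa .$$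
   Context: Setting: $\Omega\subset\mathbb{R}^n$ is a bounded domain, $Y$ is a (real) Hilbert space, $K:L^2(\Omega)\to Y$ is linear and continuous with adjoint $K^*:Y\to L^2(\Omega)$, $z\in Y$, $\alpha>0$, and $u_1<u_2<\dots<u_d$ are given real numbers, $d\ge2$. Define $g:\mathbb{R}\to\mathbb{R}\cup\{\infty\}$ by $g(v)=\frac12\big((u_i+u_{i+1})v-u_iu_{i+1}\big)$ if $v\in[u_i,u_{i+1}]$, $1\le i<d$, and $g(v)=\infty$ if $v\notin[u_1,u_d]$. Set $G(u)=\int_\Omega g(u(x))\,dx$ for $u\in L^2(\Omega)$, and $U_{\mathrm{ad}}=\{u\in L^2(\Omega): u_1\le u(x)\le u_d \text{ for a.e. } x\in\Omega\}$. Assumption REG (for a solution $\bar u$ of $(P)$, with adjoint state $\bar p:=K^*(z-K\bar u)\in L^2(\Omega)$): there exist constants $c>0$ and $\kappa>0$ such that for all sufficiently small $\varepsilon>0$ $$\operatorname{meas}\Big(\bigcup_{i=1}^{d-1}\big\{x\in\Omega:\ |\bar p(x)-\tfrac\alpha2(u_i+u_{i+1})|<\varepsilon\big\}\Big)\le c\,\varepsilon^\kappa,$$ where $\operatorname{meas}$ is Lebesgue measure. *)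

theory Defs
  imports "HOL-Analysis.Analysis"
begin

text \<open>Elements of \<open>L\<^sup>2(\<Omega>)\<close> are represented by functions on the whole space, of which only the
  values on \<open>\<Omega>\<close> matter; no quotient by almost-everywhere equality is taken.\<close>

definition L2_space :: "(real^'n) set \<Rightarrow> (real^'n \<Rightarrow> real) set" where
  "L2_space \<Omega> = {u \<in> borel_measurable (lebesgue_on \<Omega>). integrable (lebesgue_on \<Omega>) (\<lambda>x. (u x)\<^sup>2)}"

definition L2_inner :: "(real^'n) set \<Rightarrow> (real^'n \<Rightarrow> real) \<Rightarrow> (real^'n \<Rightarrow> real) \<Rightarrow> real" where
  "L2_inner \<Omega> u v = (LINT x|lebesgue_on \<Omega>. u x * v x)"

definition L2_norm :: "(real^'n) set \<Rightarrow> (real^'n \<Rightarrow> real) \<Rightarrow> real" where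
  "L2_norm \<Omega> u = sqrt (LINT x|lebesgue_on \<Omega>. (u x)\<^sup>2)"

definition L1_norm :: "(real^'n) set \<Rightarrow> (real^'n \<Rightarrow> real) \<Rightarrow> real" where
  "L1_norm \<Omega> u = (LINT x|lebesgue_on \<Omega>. \<bar>u x\<bar>)"

text \<open>Linearity together with the bound makes \<open>K\<close> agree on functions that are equal almost
  everywhere on \<open>\<Omega>\<close>, so these are exactly the continuous linear operators on \<open>L\<^sup>2(\<Omega>)\<close>.\<close>

definition bounded_linear_L2 ::
    "(real^'n) set \<Rightarrow> ((real^'n \<Rightarrow> real) \<Rightarrow> 'y::real_normed_vector) \<Rightarrow> bool" where
  "bounded_linear_L2 \<Omega> K \<longleftrightarrow>
     (\<forall>u\<in>L2_space \<Omega>. \<forall>v\<in>L2_space \<Omega>. K (\<lambda>x. u x + v x) = K u + K v) \<and>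
     (\<forall>c. \<forall>u\<in>L2_space \<Omega>. K (\<lambda>x. c * u x) = c *\<^sub>R K u) \<and>
     (\<exists>C. \<forall>u\<in>L2_space \<Omega>. norm (K u) \<le> C * L2_norm \<Omega> u)"

text \<open>By the Riesz representation theorem an adjoint exists for every such \<open>K\<close>, and each
  \<open>Kstar y\<close> is unique up to equality almost everywhere on \<open>\<Omega>\<close>.\<close>

definition is_adjoint_L2 ::
    "(real^'n) set \<Rightarrow> ((real^'n \<Rightarrow> real) \<Rightarrow> 'y::real_inner) \<Rightarrow> ('y \<Rightarrow> real^'n \<Rightarrow> real) \<Rightarrow> bool" where
  "is_adjoint_L2 \<Omega> K Kstar \<longleftrightarrow>
     (\<forall>y. Kstar y \<in> L2_space \<Omega> \<and> (\<forall>u\<in>L2_space \<Omega>. inner (K u) y = L2_inner \<Omega> u (Kstar y)))"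

text \<open>The levels are \<open>a 1 < \<dots> < a d\<close>. At an inner level both neighbouring affine pieces have the
  same value, so the choice of the least index is immaterial (see \<open>multibang_eq\<close>).\<close>

definition multibang :: "nat \<Rightarrow> (nat \<Rightarrow> real) \<Rightarrow> real \<Rightarrow> ereal" where
  "multibang d a v =
     (if \<exists>i. 1 \<le> i \<and> i < d \<and> v \<in> {a i..a (i + 1)}
      then let i = (LEAST i. 1 \<le> i \<and> i < d \<and> v \<in> {a i..a (i + 1)})
           in ereal (1/2 * ((a i + a (i + 1)) * v - a i * a (i + 1)))
      else \<infinity>)"

lemma multibang_eq:
  assumes a: "strict_mono_on {1..d} a" and i: "1 \<le> i" "i < d" and v: "v \<in> {a i..a (i + 1)}"
  shows "multibang d a v = ereal (1/2 * ((a i + a (i + 1)) * v - a i * a (i + 1)))"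
proof -
  let ?P = "\<lambda>i. 1 \<le> i \<and> i < d \<and> v \<in> {a i..a (i + 1)}"
  define j where "j = (LEAST i. ?P i)"
  have j: "?P j" unfolding j_def by (rule LeastI[of ?P i]) (use i v in auto)
  have "j \<le> i" unfolding j_def by (rule Least_le) (use i v in auto)
  have eq: "(a j + a (j + 1)) * v - a j * a (j + 1) = (a i + a (i + 1)) * v - a i * a (i + 1)"
  proof (cases "j = i")
    case False
    with \<open>j \<le> i\<close> have "j + 1 \<le> i" by simp
    moreover have "a i \<le> a (j + 1)" using j v by simp
    ultimately have "j + 1 = i"
      using strict_mono_onD[OF a, of "j + 1" i] j i by (cases "j + 1 = i") auto
    moreover from this have "v = a i" using j v by auto
    ultimately show ?thesis by (auto simp: algebra_simps)
  qed simp
  have "\<exists>i. ?P i" using i v by blast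
  then show ?thesis by (simp only: multibang_def if_True Let_def j_def[symmetric] eq)
qed

lemma multibang_eq_infinity:
  assumes a: "strict_mono_on {1..d} a" and v: "v \<notin> {a 1..a d}"
  shows "multibang d a v = \<infinity>"
proof -
  have "a 1 \<le> a i \<and> a (i + 1) \<le> a d" if "1 \<le> i" "i < d" for i
    using strict_mono_onD[OF a, of 1 i] strict_mono_onD[OF a, of "i + 1" d] that
    by (cases "i = 1"; cases "i + 1 = d") (auto intro: less_imp_le)
  then have "\<not> (\<exists>i. 1 \<le> i \<and> i < d \<and> v \<in> {a i..a (i + 1)})"
    using v by fastforce
  then show ?thesis by (simp only: multibang_def if_False)
qed

text \<open>The extended-real integral, as integral of the positive part minus integral of the
  negative part (\<open>e2ennreal\<close> sends negative arguments to \<open>0\<close>).\<close>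

definition multibang_functional ::
    "(real^'n) set \<Rightarrow> nat \<Rightarrow> (nat \<Rightarrow> real) \<Rightarrow> (real^'n \<Rightarrow> real) \<Rightarrow> ereal" where
  "multibang_functional \<Omega> d a u =
     enn2ereal (\<integral>\<^sup>+ x. e2ennreal (multibang d a (u x)) \<partial>lebesgue_on \<Omega>)
     - enn2ereal (\<integral>\<^sup>+ x. e2ennreal (- multibang d a (u x)) \<partial>lebesgue_on \<Omega>)"

definition admissible :: "(real^'n) set \<Rightarrow> nat \<Rightarrow> (nat \<Rightarrow> real) \<Rightarrow> (real^'n \<Rightarrow> real) set" where
  "admissible \<Omega> d a = {u \<in> L2_space \<Omega>. AE x in lebesgue_on \<Omega>. a 1 \<le> u x \<and> u x \<le> a d}"

definition objective ::
    "(real^'n) set \<Rightarrow> ((real^'n \<Rightarrow> real) \<Rightarrow> 'y::real_inner) \<Rightarrow> 'y \<Rightarrow> real \<Rightarrow> nat \<Rightarrow> (nat \<Rightarrow> real)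
      \<Rightarrow> (real^'n \<Rightarrow> real) \<Rightarrow> ereal" where
  "objective \<Omega> K z \<alpha> d a u =
     ereal (1/2 * (norm (K u - z))\<^sup>2) + ereal \<alpha> * multibang_functional \<Omega> d a u"

definition objective_reg ::
    "(real^'n) set \<Rightarrow> ((real^'n \<Rightarrow> real) \<Rightarrow> 'y::real_inner) \<Rightarrow> 'y \<Rightarrow> real \<Rightarrow> nat \<Rightarrow> (nat \<Rightarrow> real)
      \<Rightarrow> real \<Rightarrow> (real^'n \<Rightarrow> real) \<Rightarrow> ereal" where
  "objective_reg \<Omega> K z \<alpha> d a \<gamma> u =
     objective \<Omega> K z \<alpha> d a u + ereal (\<gamma>/2 * (L2_norm \<Omega> u)\<^sup>2)"

definition solution_P ::
    "(real^'n) set \<Rightarrow> ((real^'n \<Rightarrow> real) \<Rightarrow> 'y::real_inner) \<Rightarrow> 'y \<Rightarrow> real \<Rightarrow> nat \<Rightarrow> (nat \<Rightarrow> real)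
      \<Rightarrow> (real^'n \<Rightarrow> real) \<Rightarrow> bool" where
  "solution_P \<Omega> K z \<alpha> d a u \<longleftrightarrow>
     is_arg_min (objective \<Omega> K z \<alpha> d a) (\<lambda>v. v \<in> admissible \<Omega> d a) u"

definition solution_P_reg ::
    "(real^'n) set \<Rightarrow> ((real^'n \<Rightarrow> real) \<Rightarrow> 'y::real_inner) \<Rightarrow> 'y \<Rightarrow> real \<Rightarrow> nat \<Rightarrow> (nat \<Rightarrow> real)
      \<Rightarrow> real \<Rightarrow> (real^'n \<Rightarrow> real) \<Rightarrow> bool" where
  "solution_P_reg \<Omega> K z \<alpha> d a \<gamma> u \<longleftrightarrow>
     is_arg_min (objective_reg \<Omega> K z \<alpha> d a \<gamma>) (\<lambda>v. v \<in> admissible \<Omega> d a) u"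

definition REG ::
    "(real^'n) set \<Rightarrow> real \<Rightarrow> nat \<Rightarrow> (nat \<Rightarrow> real) \<Rightarrow> (real^'n \<Rightarrow> real) \<Rightarrow> real \<Rightarrow> bool" where
  "REG \<Omega> \<alpha> d a p \<kappa> \<longleftrightarrow> \<kappa> > 0 \<and>
     (\<exists>c>0. \<forall>\<^sub>F \<epsilon> in at_right 0.
        measure lebesgue (\<Union>i\<in>{1..d - 1}. {x \<in> \<Omega>. \<bar>p x - \<alpha>/2 * (a i + a (i + 1))\<bar> < \<epsilon>})
          \<le> c * \<epsilon> powr \<kappa>)"

end

theory Submission
  imports Defs
begin

text \<open>With \<open>p = K\<^sup>*(z - K ubar)\<close> and \<open>h\<^sub>x(v) = \<alpha> g(v) - p(x) v\<close>, the objective satisfies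
  \<open>J(u) - J(ubar) = 1/2 \<parallel>K(u - ubar)\<parallel>\<^sup>2 + gap(u)\<close> with \<open>gap(u) = \<integral> h\<^sub>x(u) - h\<^sub>x(ubar)\<close>.
  Convexity of \<open>g\<close> and minimality of \<open>ubar\<close> give \<open>gap \<ge> 0\<close>. Pointwise, \<open>h\<^sub>x\<close> is minimised at a level
  \<open>v(x)\<close>, and it grows away from \<open>v(x)\<close> with slope at least \<open>\<epsilon>\<close> unless \<open>p(x)\<close> is \<open>\<epsilon>\<close>-close
  to a switching value \<open>\<alpha>/2 (a i + a (i + 1))\<close>. Applying this to \<open>u\<close> and to \<open>ubar\<close> and using
  \<open>gap(v) \<ge> 0\<close> yields \<open>gap(u) \<ge> \<epsilon> (\<parallel>u - ubar\<parallel>\<^sub>1 - O(\<epsilon>\<^sup>\<kappa>))\<close>. Comparing \<open>u\<^sub>\<gamma>\<close> with \<open>ubar\<close> in the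
  regularised problem bounds \<open>1/2 \<parallel>K(u\<^sub>\<gamma> - ubar)\<parallel>\<^sup>2 + gap(u\<^sub>\<gamma>) + \<gamma>/2 \<parallel>u\<^sub>\<gamma> - ubar\<parallel>\<^sup>2\<close> by
  \<open>\<gamma> A \<parallel>u\<^sub>\<gamma> - ubar\<parallel>\<^sub>1\<close>, where \<open>A\<close> bounds \<open>\<bar>ubar\<bar>\<close>, and \<open>\<epsilon> = 2 A \<gamma>\<close> absorbs the right-hand side.\<close>

section \<open>The multibang penalty as a real function and its pointwise minimiser\<close>

definition affine_piece :: "(nat \<Rightarrow> real) \<Rightarrow> nat \<Rightarrow> real \<Rightarrow> real" where
  "affine_piece a i v = 1/2 * ((a i + a (i + 1)) * v - a i * a (i + 1))"

text \<open>A maximum of affine functions is real-valued and convex on the whole line, so convexity,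
  continuity and Bochner integration apply without extended reals. It agrees with
  \<open>multibang\<close> on \<open>{a 1..a d}\<close> (\<open>multibang_eq_real\<close>).\<close>

definition multibang_real :: "nat \<Rightarrow> (nat \<Rightarrow> real) \<Rightarrow> real \<Rightarrow> real" where
  "multibang_real d a v = Max ((\<lambda>i. affine_piece a i v) ` {1..<d})"

text \<open>The pointwise minimiser of \<open>\<alpha> g(v) - q v\<close>: each \<open>q\<close> above a switching value passes one more level.\<close>

definition bang :: "real \<Rightarrow> nat \<Rightarrow> (nat \<Rightarrow> real) \<Rightarrow> real \<Rightarrow> real" where
  "bang \<alpha> d a q = a 1 + (\<Sum>i\<in>{1..<d}. if \<alpha>/2 * (a i + a (i + 1)) < q then a (i + 1) - a i else 0)"

text \<open>All pieces differ from the same parabola by a quadratic vanishing at their end points, so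
  comparing two pieces amounts to comparing signs.\<close>

lemma affine_piece_parabola: "affine_piece a i v = v\<^sup>2/2 - (v - a i) * (v - a (i + 1)) / 2"
  by (simp add: affine_piece_def power2_eq_square field_simps)

locale multibang_levels =
  fixes d :: nat and a :: "nat \<Rightarrow> real"
  assumes d_ge_2: "d \<ge> 2" and mono_a: "strict_mono_on {1..d} a"
begin

abbreviation g :: "real \<Rightarrow> real" where "g \<equiv> multibang_real d a"

lemma level_le: "1 \<le> i \<Longrightarrow> i \<le> j \<Longrightarrow> j \<le> d \<Longrightarrow> a i \<le> a j"
  using strict_mono_onD[OF mono_a, of i j] by (cases "i = j") (auto intro: less_imp_le)

lemma level_less: "1 \<le> i \<Longrightarrow> i < j \<Longrightarrow> j \<le> d \<Longrightarrow> a i < a j"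
  using strict_mono_onD[OF mono_a, of i j] by auto

lemma affine_piece_le: "1 \<le> i \<Longrightarrow> i < d \<Longrightarrow> affine_piece a i v \<le> g v"
  unfolding multibang_real_def by (intro Max_ge) auto

lemma multibang_real_leI:
  assumes "\<And>i. 1 \<le> i \<Longrightarrow> i < d \<Longrightarrow> affine_piece a i v \<le> b"
  shows "g v \<le> b"
  unfolding multibang_real_def using d_ge_2 assms by (intro Max.boundedI) auto

text \<open>The correction \<open>(v - a i) * (v - a (i + 1))\<close> is nonpositive for
  \<open>i = j\<close> and nonnegative for every other \<open>i\<close>, because then
  \<open>v\<close> lies on one side of both end points. Hence piece \<open>j\<close> attains the
  maximum.\<close>

lemma multibang_real_eq:
  assumes j: "1 \<le> j" "j < d" and v: "v \<in> {a j..a (j + 1)}"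
  shows "g v = affine_piece a j v"
proof (rule antisym)
  show "g v \<le> affine_piece a j v"
  proof (rule multibang_real_leI)
    fix i assume i: "1 \<le> i" "i < d"
    have neg: "(v - a j) * (v - a (j + 1)) \<le> 0"
      using v by (intro mult_nonneg_nonpos) auto
    consider "i < j" | "i = j" | "j < i" by linarith
    then show "affine_piece a i v \<le> affine_piece a j v"
    proof cases
      case 1
      then have "a i \<le> v" "a (i + 1) \<le> v"
        using level_le[of i j] level_le[of "i + 1" j] i j v by auto
      then have "0 \<le> (v - a i) * (v - a (i + 1))" by simp
      with neg show ?thesis by (simp add: affine_piece_parabola)
    next
      case 3
      then have "v \<le> a i" "v \<le> a (i + 1)"
        using level_le[of "j + 1" i] level_le[of "j + 1" "i + 1"] i j v by auto
      then have "0 \<le> (v - a i) * (v - a (i + 1))" by (simp add: mult_nonpos_nonpos)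
      with neg show ?thesis by (simp add: affine_piece_parabola)
    qed simp
  qed
qed (use affine_piece_le j in auto)

lemma piece_exists:
  assumes "v \<in> {a 1..a d}"
  obtains j where "1 \<le> j" "j < d" "v \<in> {a j..a (j + 1)}"
proof -
  \<comment> \<open>Starting the search at 2 makes the predecessor of the least \<open>k\<close> a
    valid piece index. For \<open>k = 2\<close> its left bound is \<open>a 1 \<le> v\<close> from
    the assumption, otherwise it comes from minimality of \<open>k\<close>.\<close>
  define P where "P k \<longleftrightarrow> 2 \<le> k \<and> v \<le> a k" for k
  define k where "k = (LEAST k. P k)"
  have Pd: "P d" using assms d_ge_2 by (simp add: P_def)
  then have "P k" unfolding k_def by (rule LeastI)
  moreover have "k \<le> d" unfolding k_def using Pd by (rule Least_le)
  moreover have "\<not> P (k - 1)"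
  proof -
    have "k - 1 < k" using \<open>P k\<close> by (auto simp: P_def)
    then show ?thesis unfolding k_def by (rule not_less_Least)
  qed
  ultimately show ?thesis
    using assms by (intro that[of "k - 1"]) (auto simp: P_def not_le le_less numeral_2_eq_2 Suc_le_eq
      dest: less_antisym)
qed

lemma multibang_real_level:
  assumes "1 \<le> j" "j \<le> d"
  shows "g (a j) = (a j)\<^sup>2 / 2"
proof (cases "j < d")
  case True
  then show ?thesis
    using assms level_le[of j "j + 1"]
    by (subst multibang_real_eq[of j]) (auto simp: affine_piece_parabola)
next
  case False
  then show ?thesis
    using assms d_ge_2 level_le[of "j - 1" j]
    by (subst multibang_real_eq[of "j - 1"]) (auto simp: affine_piece_parabola)
qed

lemma multibang_eq_real:
  assumes "v \<in> {a 1..a d}"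
  shows "multibang d a v = ereal (g v)"
  using assms
  by (rule piece_exists)
     (simp add: multibang_eq[OF mono_a] multibang_real_eq affine_piece_def del: atLeastAtMost_iff)

lemma convex_multibang_real: "convex_on UNIV g"
proof (rule convex_onI)
  fix t x y :: real
  assume t: "0 < t" "t < 1"
  show "g ((1 - t) *\<^sub>R x + t *\<^sub>R y) \<le> (1 - t) * g x + t * g y"
  proof (rule multibang_real_leI)
    fix i assume i: "1 \<le> i" "i < d"
    have "affine_piece a i ((1 - t) *\<^sub>R x + t *\<^sub>R y)
        = (1 - t) * affine_piece a i x + t * affine_piece a i y"
      by (simp add: affine_piece_def field_simps)
    also have "\<dots> \<le> (1 - t) * g x + t * g y"
      using t affine_piece_le[OF i] by (intro add_mono mult_left_mono) auto
    finally show "affine_piece a i ((1 - t) *\<^sub>R x + t *\<^sub>R y) \<le> (1 - t) * g x + t * g y" .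
  qed
qed simp

lemma continuous_multibang_real: "continuous_on UNIV g"
  using convex_multibang_real by (intro convex_on_continuous) auto

lemma measurable_multibang_real [measurable]: "g \<in> borel_measurable borel"
  using continuous_multibang_real by (rule borel_measurable_continuous_onI)

lemma multibang_real_bounded: "\<exists>B. \<forall>v\<in>{a 1..a d}. \<bar>g v\<bar> \<le> B"
proof -
  have "bounded (g ` {a 1..a d})"
    using continuous_on_subset[OF continuous_multibang_real]
    by (intro compact_imp_bounded compact_continuous_image) auto
  then show ?thesis unfolding bounded_iff by auto
qed

text \<open>The piece adjacent to \<open>a j\<close> on the side of \<open>v\<close> lies below
  \<open>g\<close> and agrees with it at \<open>a j\<close>. Its slope times \<open>\<alpha>\<close>
  is a switching value, which the hypotheses separate from \<open>q\<close> by the margin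
  \<open>e\<close> on the correct side.\<close>

lemma level_growth:
  assumes j: "1 \<le> j" "j \<le> d" and v: "v \<in> {a 1..a d}"
    and lower: "\<And>i. 1 \<le> i \<Longrightarrow> i < j \<Longrightarrow> \<alpha>/2 * (a i + a (i + 1)) + e \<le> q"
    and upper: "\<And>i. j \<le> i \<Longrightarrow> i < d \<Longrightarrow> q + e \<le> \<alpha>/2 * (a i + a (i + 1))"
    and \<alpha>: "\<alpha> \<ge> 0"
  shows "e * \<bar>v - a j\<bar> \<le> \<alpha> * g v - \<alpha> * g (a j) - q * (v - a j)"
proof -
  consider "v = a j" | "a j < v" | "v < a j" by linarith
  then show ?thesis
  proof cases
    case 2
    then have jd: "j < d" using j v by (cases "j = d") auto
    have "e * (v - a j) \<le> (\<alpha>/2 * (a j + a (j + 1)) - q) * (v - a j)"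
      using upper[of j] jd 2 by (intro mult_right_mono) auto
    also have "\<dots> = \<alpha> * affine_piece a j v - \<alpha> * g (a j) - q * (v - a j)"
      by (simp add: multibang_real_level[OF j] affine_piece_def power2_eq_square field_simps)
    also have "\<alpha> * affine_piece a j v \<le> \<alpha> * g v"
      using affine_piece_le[of j v] j jd \<alpha> by (intro mult_left_mono) auto
    finally show ?thesis using 2 by simp
  next
    case 3
    then have j1: "1 < j" using j v by (cases "j = 1") auto
    have "e * (a j - v) \<le> (q - \<alpha>/2 * (a (j - 1) + a j)) * (a j - v)"
    proof (intro mult_right_mono)
      have "1 \<le> j - 1" "j - 1 < j" using j1 by auto
      from lower[OF this] show "e \<le> q - \<alpha>/2 * (a (j - 1) + a j)" using j1 by simp
    qed (use 3 in simp)
    also have "\<dots> = \<alpha> * affine_piece a (j - 1) v - \<alpha> * g (a j) - q * (v - a j)"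
      using j1 by (simp add: multibang_real_level[OF j] affine_piece_def power2_eq_square field_simps)
    also have "\<alpha> * affine_piece a (j - 1) v \<le> \<alpha> * g v"
      using affine_piece_le[of "j - 1" v] j j1 \<alpha> by (intro mult_left_mono) auto
    finally show ?thesis using 3 by simp
  qed simp
qed

text \<open>Switching values increase with the index, so those below \<open>q\<close> form an
  initial segment and the sum in \<open>bang\<close> telescopes to a level. A tie is resolved
  towards the lower level, hence one strict and one weak inequality.\<close>

lemma bang_level:
  assumes \<alpha>: "\<alpha> > 0"
  obtains j where "1 \<le> j" "j \<le> d" "bang \<alpha> d a q = a j"
    "\<And>i. 1 \<le> i \<Longrightarrow> i < j \<Longrightarrow> \<alpha>/2 * (a i + a (i + 1)) < q"
    "\<And>i. j \<le> i \<Longrightarrow> i < d \<Longrightarrow> q \<le> \<alpha>/2 * (a i + a (i + 1))"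
proof -
  define t where "t i = \<alpha>/2 * (a i + a (i + 1))" for i
  \<comment> \<open>The alternative \<open>k = d\<close> provides a witness when \<open>q\<close>
    exceeds every switching value.\<close>
  define P where "P k \<longleftrightarrow> 1 \<le> k \<and> (k = d \<or> q \<le> t k)" for k
  define j where "j = (LEAST k. P k)"
  have Pd: "P d" using d_ge_2 by (simp add: P_def)
  then have j: "P j" unfolding j_def by (rule LeastI)
  have jd: "j \<le> d" unfolding j_def using Pd by (rule Least_le)
  have lower: "t i < q" if "1 \<le> i" "i < j" for i
  proof -
    have "\<not> P i" using that(2) unfolding j_def by (rule not_less_Least)
    then show ?thesis using that jd by (auto simp: P_def)
  qed
  have upper: "q \<le> t i" if "j \<le> i" "i < d" for i
  proof -
    have "q \<le> t j" using j that by (auto simp: P_def)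
    also have "\<dots> \<le> t i"
      using that j level_le[of j i] level_le[of "j + 1" "i + 1"] \<alpha> by (auto simp: t_def P_def)
    finally show ?thesis .
  qed
  have "(\<Sum>i\<in>{1..<d}. if t i < q then a (i + 1) - a i else 0) = (\<Sum>i\<in>{1..<j}. a (Suc i) - a i)"
    using jd lower upper by (intro sum.mono_neutral_cong_right) (force simp: not_less)+
  also have "\<dots> = a j - a 1" using j by (intro sum_Suc_diff') (auto simp: P_def)
  finally have "bang \<alpha> d a q = a j" by (simp add: bang_def t_def)
  with j jd lower upper show ?thesis by (intro that[of j]) (auto simp: P_def t_def)
qed

lemma bang_mem: "\<alpha> > 0 \<Longrightarrow> bang \<alpha> d a q \<in> {a 1..a d}"
  by (rule bang_level[of \<alpha> q]) (auto intro: level_le)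

text \<open>Distance at least \<open>e\<close> from all switching values upgrades the inequalities
  of \<open>bang_level\<close> to the margins that \<open>level_growth\<close> asks for. The case
  \<open>e = 0\<close> says that \<open>bang\<close> minimises over
  \<open>{a 1..a d}\<close>.\<close>

lemma bang_growth:
  assumes "\<alpha> > 0" "v \<in> {a 1..a d}"
    and "\<And>i. 1 \<le> i \<Longrightarrow> i < d \<Longrightarrow> e \<le> \<bar>q - \<alpha>/2 * (a i + a (i + 1))\<bar>"
  shows "e * \<bar>v - bang \<alpha> d a q\<bar> \<le> \<alpha> * g v - \<alpha> * g (bang \<alpha> d a q) - q * (v - bang \<alpha> d a q)"
proof -
  obtain j where j: "1 \<le> j" "j \<le> d" "bang \<alpha> d a q = a j"
    and l: "\<And>i. 1 \<le> i \<Longrightarrow> i < j \<Longrightarrow> \<alpha>/2 * (a i + a (i + 1)) < q"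
    and u: "\<And>i. j \<le> i \<Longrightarrow> i < d \<Longrightarrow> q \<le> \<alpha>/2 * (a i + a (i + 1))"
    using bang_level[OF assms(1)] by metis
  show ?thesis unfolding j(3)
  proof (rule level_growth)
    fix i assume "1 \<le> i" "i < j"
    then show "\<alpha>/2 * (a i + a (i + 1)) + e \<le> q" using l[of i] assms(3)[of i] j by linarith
  next
    fix i assume "j \<le> i" "i < d"
    then show "q + e \<le> \<alpha>/2 * (a i + a (i + 1))" using u[of i] assms(3)[of i] j by linarith
  qed (use assms j in auto)
qed

lemma measurable_bang [measurable]: "bang \<alpha> d a \<in> borel_measurable borel"
  unfolding bang_def by measurable

lemma levels_abs_le: "v \<in> {a 1..a d} \<Longrightarrow> \<bar>v\<bar> \<le> \<bar>a 1\<bar> + \<bar>a d\<bar>"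
  by auto

end

section \<open>Square-integrable functions and the control operator\<close>

lemma L2_mult_integrable:
  assumes "u \<in> L2_space \<Omega>" "v \<in> L2_space \<Omega>"
  shows "integrable (lebesgue_on \<Omega>) (\<lambda>x. u x * v x)"
proof (rule Bochner_Integration.integrable_bound)
  show "integrable (lebesgue_on \<Omega>) (\<lambda>x. (u x)\<^sup>2 + (v x)\<^sup>2)"
    using assms by (auto simp: L2_space_def)
  show "(\<lambda>x. u x * v x) \<in> borel_measurable (lebesgue_on \<Omega>)"
    using assms by (auto simp: L2_space_def)
  have "\<bar>s * t\<bar> \<le> s\<^sup>2 + t\<^sup>2" for s t :: real
    using sum_squares_bound[of "\<bar>s\<bar>" "\<bar>t\<bar>"] mult_nonneg_nonneg[OF abs_ge_zero abs_ge_zero, of s t]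
    unfolding abs_mult power2_abs mult.assoc by linarith
  then show "AE x in lebesgue_on \<Omega>. norm (u x * v x) \<le> norm ((u x)\<^sup>2 + (v x)\<^sup>2)"
    by simp
qed

lemma L2_scale: "u \<in> L2_space \<Omega> \<Longrightarrow> (\<lambda>x. c * u x) \<in> L2_space \<Omega>"
  by (auto simp: L2_space_def power_mult_distrib)

lemma L2_add:
  assumes "u \<in> L2_space \<Omega>" "v \<in> L2_space \<Omega>"
  shows "(\<lambda>x. u x + v x) \<in> L2_space \<Omega>"
proof -
  have "integrable (lebesgue_on \<Omega>) (\<lambda>x. (u x)\<^sup>2 + (v x)\<^sup>2 + 2 * (u x * v x))"
    using assms L2_mult_integrable[OF assms] by (auto simp: L2_space_def)
  moreover have "(\<lambda>x. (u x)\<^sup>2 + (v x)\<^sup>2 + 2 * (u x * v x)) = (\<lambda>x. (u x + v x)\<^sup>2)"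
    by (simp add: power2_sum mult.assoc)
  ultimately show ?thesis using assms by (auto simp: L2_space_def)
qed

lemma L2_diff:
  assumes "u \<in> L2_space \<Omega>" "v \<in> L2_space \<Omega>"
  shows "(\<lambda>x. u x - v x) \<in> L2_space \<Omega>"
  using L2_add[OF assms(1) L2_scale[OF assms(2), of "-1"]] by simp

lemma bounded_linear_L2_diff:
  assumes K: "bounded_linear_L2 \<Omega> K" and "u \<in> L2_space \<Omega>" "v \<in> L2_space \<Omega>"
  shows "K (\<lambda>x. u x - v x) = K u - K v"
proof -
  have add: "K (\<lambda>x. u x + v x) = K u + K v"
    if "u \<in> L2_space \<Omega>" "v \<in> L2_space \<Omega>" for u v
    using K that by (simp add: bounded_linear_L2_def)
  have "K (\<lambda>x. u x + - 1 * v x) = K u + K (\<lambda>x. - 1 * v x)"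
    by (rule add[OF assms(2) L2_scale[OF assms(3)]])
  also have "K (\<lambda>x. - 1 * v x) = (- 1) *\<^sub>R K v"
    using K assms(3) by (simp only: bounded_linear_L2_def)
  finally show ?thesis by simp
qed

section \<open>Admissible controls and the real-valued objective\<close>

locale multibang_control = multibang_levels d a
  for d :: nat and a :: "nat \<Rightarrow> real" +
  fixes \<Omega> :: "(real^'n) set"
    and K :: "(real^'n \<Rightarrow> real) \<Rightarrow> 'y::real_inner"
    and Kstar :: "'y \<Rightarrow> real^'n \<Rightarrow> real"
    and z :: 'y
    and \<alpha> :: real
    and ubar :: "real^'n \<Rightarrow> real"
  assumes \<Omega>_lmeasurable: "\<Omega> \<in> lmeasurable"
    and K_linear: "bounded_linear_L2 \<Omega> K"
    and K_adjoint: "is_adjoint_L2 \<Omega> K Kstar"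
    and \<alpha>_pos: "\<alpha> > 0"
    and ubar_solution: "solution_P \<Omega> K z \<alpha> d a ubar"
begin

abbreviation M where "M \<equiv> lebesgue_on \<Omega>"

abbreviation p where "p \<equiv> Kstar (z - K ubar)"

sublocale fin: finite_measure M
  using \<Omega>_lmeasurable by (rule finite_measure_lebesgue_on)

lemma admissible_L2: "u \<in> admissible \<Omega> d a \<Longrightarrow> u \<in> L2_space \<Omega>"
  by (simp add: admissible_def)

lemma admissible_measurable: "u \<in> admissible \<Omega> d a \<Longrightarrow> u \<in> borel_measurable M"
  by (simp add: admissible_def L2_space_def)

lemma admissible_AE: "u \<in> admissible \<Omega> d a \<Longrightarrow> AE x in M. u x \<in> {a 1..a d}"
  by (simp add: admissible_def)

lemma admissible_integrable_bounded:
  assumes u: "u \<in> borel_measurable M" "AE x in M. u x \<in> {a 1..a d}"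
    and f: "f \<in> borel_measurable borel" "\<And>v. v \<in> {a 1..a d} \<Longrightarrow> \<bar>f v\<bar> \<le> B"
  shows "integrable M (\<lambda>x. f (u x) :: real)"
proof (rule fin.integrable_const_bound)
  show "AE x in M. norm (f (u x)) \<le> B"
    using u(2) by eventually_elim (use f(2) in auto)
qed (use u f in measurable)

lemma admissibleI:
  assumes "u \<in> borel_measurable M" "AE x in M. u x \<in> {a 1..a d}"
  shows "u \<in> admissible \<Omega> d a"
proof -
  have "integrable M (\<lambda>x. (u x)\<^sup>2)"
    using assms
  proof (rule admissible_integrable_bounded)
    show "\<bar>v\<^sup>2\<bar> \<le> (\<bar>a 1\<bar> + \<bar>a d\<bar>)\<^sup>2" if "v \<in> {a 1..a d}" for v
      using levels_abs_le[OF that] power_mono[of "\<bar>v\<bar>" "\<bar>a 1\<bar> + \<bar>a d\<bar>" 2] by simp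
  qed measurable
  then show ?thesis using assms by (simp add: admissible_def L2_space_def)
qed

lemma admissible_integrable_g:
  assumes "u \<in> admissible \<Omega> d a"
  shows "integrable M (\<lambda>x. g (u x))"
proof -
  obtain B where "\<And>v. v \<in> {a 1..a d} \<Longrightarrow> \<bar>g v\<bar> \<le> B" using multibang_real_bounded by blast
  then show ?thesis
    using admissible_integrable_bounded[OF admissible_measurable admissible_AE
        measurable_multibang_real] assms by blast
qed

lemma p_L2: "p \<in> L2_space \<Omega>"
  using K_adjoint by (simp add: is_adjoint_L2_def)

lemma p_measurable: "p \<in> borel_measurable M"
  using p_L2 by (simp add: L2_space_def)

lemma ubar_admissible: "ubar \<in> admissible \<Omega> d a"
  using ubar_solution by (simp add: solution_P_def is_arg_min_def)

lemma integrable_abs_diff: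
  assumes u: "u \<in> admissible \<Omega> d a"
  shows "integrable M (\<lambda>x. \<bar>u x - ubar x\<bar>)"
proof (rule fin.integrable_const_bound)
  show "AE x in M. norm \<bar>u x - ubar x\<bar> \<le> a d - a 1"
    using admissible_AE[OF u] admissible_AE[OF ubar_admissible] by eventually_elim auto
qed (use admissible_measurable u ubar_admissible in measurable)

definition J :: "(real^'n \<Rightarrow> real) \<Rightarrow> real" where
  "J u = 1/2 * (norm (K u - z))\<^sup>2 + \<alpha> * (LINT x|M. g (u x))"

text \<open>On an admissible control the penalty is finite almost everywhere and integrable, so both
  parts have finite integrals and their extended-real difference is the Bochner integral.\<close>

lemma multibang_functional_eq:
  assumes u: "u \<in> admissible \<Omega> d a"
  shows "multibang_functional \<Omega> d a u = ereal (LINT x|M. g (u x))"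
proof -
  have "AE x in M. multibang d a (u x) = ereal (g (u x))"
    using admissible_AE[OF u] by eventually_elim (rule multibang_eq_real)
  then have "(\<integral>\<^sup>+ x. e2ennreal (multibang d a (u x)) \<partial>M) = (\<integral>\<^sup>+ x. ennreal (g (u x)) \<partial>M)"
    "(\<integral>\<^sup>+ x. e2ennreal (- multibang d a (u x)) \<partial>M) = (\<integral>\<^sup>+ x. ennreal (- g (u x)) \<partial>M)"
    by (auto intro!: nn_integral_cong_AE elim!: eventually_mono)
  moreover obtain r q where "0 \<le> r" "0 \<le> q"
    "(\<integral>\<^sup>+ x. ennreal (g (u x)) \<partial>M) = ennreal r" "(\<integral>\<^sup>+ x. ennreal (- g (u x)) \<partial>M) = ennreal q"
    "(LINT x|M. g (u x)) = r - q"
    using integrableE[OF admissible_integrable_g[OF u]] by metis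
  ultimately show ?thesis by (simp add: multibang_functional_def enn2ereal_ennreal)
qed

lemma objective_eq: "u \<in> admissible \<Omega> d a \<Longrightarrow> objective \<Omega> K z \<alpha> d a u = ereal (J u)"
  by (simp add: objective_def multibang_functional_eq J_def)

lemma ubar_minimal: "u \<in> admissible \<Omega> d a \<Longrightarrow> J ubar \<le> J u"
  using ubar_solution ubar_admissible
  by (auto simp: solution_P_def is_arg_min_def objective_eq not_less)

section \<open>Expansion of the objective around \<open>ubar\<close> and first-order
  optimality\<close>

definition h :: "(real^'n) \<Rightarrow> real \<Rightarrow> real" where
  "h x v = \<alpha> * g v - p x * v"

text \<open>Since \<open>- p\<close> is the gradient of the quadratic term at \<open>ubar\<close>,
  this is the increase of the objective with that term linearised at \<open>ubar\<close>.\<close>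

definition gap :: "(real^'n \<Rightarrow> real) \<Rightarrow> real" where
  "gap u = (LINT x|M. h x (u x)) - (LINT x|M. h x (ubar x))"

lemma integrable_h: "u \<in> admissible \<Omega> d a \<Longrightarrow> integrable M (\<lambda>x. h x (u x))"
  unfolding h_def
  by (intro Bochner_Integration.integrable_diff integrable_mult_right admissible_integrable_g
      L2_mult_integrable p_L2 admissible_L2)

text \<open>The squared norm has an exact second-order expansion; the adjoint turns its linear part
  into the integral of \<open>p x * (u x - ubar x)\<close>, which \<open>gap\<close>
  absorbs.\<close>

lemma J_expansion:
  assumes u: "u \<in> admissible \<Omega> d a"
  shows "J u = J ubar + 1/2 * (norm (K u - K ubar))\<^sup>2 + gap u"
proof -
  note [simp] = L2_mult_integrable[OF p_L2 admissible_L2[OF u]] admissible_integrable_g[OF u]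
    L2_mult_integrable[OF p_L2 admissible_L2[OF ubar_admissible]]
    admissible_integrable_g[OF ubar_admissible]
  have "inner (K u - K ubar) (z - K ubar) = inner (K (\<lambda>x. u x - ubar x)) (z - K ubar)"
    using u ubar_admissible by (simp add: bounded_linear_L2_diff[OF K_linear] admissible_L2)
  also have "\<dots> = L2_inner \<Omega> (\<lambda>x. u x - ubar x) p"
    using K_adjoint L2_diff[OF admissible_L2[OF u] admissible_L2[OF ubar_admissible]]
    by (simp only: is_adjoint_L2_def)
  also have "\<dots> = (LINT x|M. p x * u x - p x * ubar x)"
    by (simp add: L2_inner_def left_diff_distrib mult.commute[of "p _"])
  also have "\<dots> = (LINT x|M. p x * u x) - (LINT x|M. p x * ubar x)"
    by simp
  finally have "gap u = \<alpha> * (LINT x|M. g (u x)) - \<alpha> * (LINT x|M. g (ubar x))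
      - inner (K u - K ubar) (z - K ubar)"
    by (simp add: gap_def h_def)
  moreover have "(norm (K u - z))\<^sup>2 = (norm (K ubar - z))\<^sup>2 + (norm (K u - K ubar))\<^sup>2
      - 2 * inner (K u - K ubar) (z - K ubar)"
    by (simp add: power2_norm_eq_inner inner_diff_left inner_diff_right inner_commute algebra_simps)
  ultimately show ?thesis by (simp add: J_def)
qed

text \<open>Along the segment from \<open>ubar\<close> to \<open>v\<close>, convexity bounds the gap
  by \<open>t * gap v\<close> while the quadratic remainder is of order \<open>t\<^sup>2\<close>. A
  negative gap would thus push \<open>J\<close> below its minimum for small
  \<open>t\<close>.\<close>

lemma gap_nonneg:
  assumes v: "v \<in> admissible \<Omega> d a"
  shows "gap v \<ge> 0"
proof (rule ccontr)
  assume neg: "\<not> gap v \<ge> 0"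
  define N where "N = (norm (K v - K ubar))\<^sup>2"
  \<comment> \<open>The bound 1 keeps \<open>w\<close> on the segment. The other bound makes
    \<open>t * N / 2\<close> smaller than \<open>- gap v\<close>, and the summand 1 avoids a zero
    denominator.\<close>
  define t where "t = min 1 (- gap v / (N + 1))"
  define w where "w = (\<lambda>x. ubar x + t * (v x - ubar x))"
  have N: "N \<ge> 0" by (simp add: N_def)
  have t: "0 < t" "t \<le> 1" using neg N by (auto simp: t_def intro!: divide_neg_pos)
  have w_conv: "w x = (1 - t) * ubar x + t * v x" for x by (simp add: w_def algebra_simps)
  have w: "w \<in> admissible \<Omega> d a"
  proof (rule admissibleI)
    show "w \<in> borel_measurable M"
      unfolding w_def using admissible_measurable[OF v] admissible_measurable[OF ubar_admissible]
      by measurable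
    show "AE x in M. w x \<in> {a 1..a d}"
      using admissible_AE[OF v] admissible_AE[OF ubar_admissible]
    proof eventually_elim
      case (elim x)
      then have "(1 - t) *\<^sub>R ubar x + t *\<^sub>R v x \<in> {a 1..a d}"
        using t convex_real_interval(5)[of "a 1" "a d"] by (intro convexD) auto
      then show ?case by (simp add: w_conv)
    qed
  qed
  have "K w - K ubar = K (\<lambda>x. t * (v x - ubar x))"
    using bounded_linear_L2_diff[OF K_linear admissible_L2[OF w] admissible_L2[OF ubar_admissible]]
    by (simp add: w_def)
  also have "\<dots> = t *\<^sub>R K (\<lambda>x. v x - ubar x)"
    using K_linear L2_diff[OF admissible_L2[OF v] admissible_L2[OF ubar_admissible]]
    by (simp add: bounded_linear_L2_def)
  also have "\<dots> = t *\<^sub>R (K v - K ubar)"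
    using bounded_linear_L2_diff[OF K_linear admissible_L2[OF v] admissible_L2[OF ubar_admissible]]
    by simp
  finally have Kw: "(norm (K w - K ubar))\<^sup>2 = t\<^sup>2 * N"
    by (simp add: N_def power_mult_distrib)
  have "(LINT x|M. h x (w x)) \<le> (LINT x|M. (1 - t) * h x (ubar x) + t * h x (v x))"
  proof (rule integral_mono)
    fix x
    have "g (w x) \<le> (1 - t) * g (ubar x) + t * g (v x)"
      using convex_onD[OF convex_multibang_real, of t "ubar x" "v x"] t by (simp add: w_conv)
    then have "\<alpha> * g (w x) \<le> \<alpha> * ((1 - t) * g (ubar x) + t * g (v x))"
      using \<alpha>_pos by (intro mult_left_mono) auto
    then show "h x (w x) \<le> (1 - t) * h x (ubar x) + t * h x (v x)"
      by (simp add: h_def w_conv algebra_simps)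
  qed (use integrable_h v w ubar_admissible in auto)
  also have "\<dots> = (1 - t) * (LINT x|M. h x (ubar x)) + t * (LINT x|M. h x (v x))"
    using integrable_h[OF v] integrable_h[OF ubar_admissible] by simp
  finally have "gap w \<le> t * gap v" by (simp add: gap_def algebra_simps)
  then have "0 \<le> 1/2 * (t\<^sup>2 * N) + t * gap v"
    using ubar_minimal[OF w] J_expansion[OF w] Kw by simp
  then have "0 \<le> t * (t * N / 2 + gap v)" by (simp add: power2_eq_square algebra_simps)
  then have "- gap v \<le> t * N / 2" using t by (simp add: zero_le_mult_iff)
  also have "\<dots> \<le> (- gap v / (N + 1)) * N / 2"
    using N by (intro divide_right_mono mult_right_mono) (auto simp: t_def)
  also have "\<dots> = - gap v * (N / (N + 1)) / 2" by simp
  also have "\<dots> < - gap v * 2 / 2"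
  proof (intro divide_strict_right_mono mult_strict_left_mono)
    show "N / (N + 1) < 2" using N by (simp add: field_simps)
  qed (use neg in auto)
  finally show False by simp
qed

section \<open>Growth of the gap away from the switching values\<close>

definition near_switch :: "real \<Rightarrow> (real^'n) set" where
  "near_switch e = (\<Union>i\<in>{1..d - 1}. {x \<in> \<Omega>. \<bar>p x - \<alpha>/2 * (a i + a (i + 1))\<bar> < e})"

lemma near_switch_sets: "near_switch e \<in> sets M"
proof -
  have "{x \<in> space M. \<bar>p x - \<alpha>/2 * (a i + a (i + 1))\<bar> < e} \<in> sets M" for i
    using p_measurable by measurable
  then show ?thesis unfolding near_switch_def by auto
qed

lemma measure_near_switch: "measure M (near_switch e) = measure lebesgue (near_switch e)"
  using \<Omega>_lmeasurable
  by (intro measure_restrict_space) (auto simp: near_switch_def fmeasurableD)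

lemma gap_growth:
  assumes u: "u \<in> admissible \<Omega> d a" and e: "e \<ge> 0"
  shows "e * L1_norm \<Omega> (\<lambda>x. u x - ubar x)
    \<le> gap u + e * (a d - a 1) * measure lebesgue (near_switch e)"
proof -
  define v where "v x = bang \<alpha> d a (p x)" for x
  have v: "v \<in> admissible \<Omega> d a"
  proof (rule admissibleI)
    show "v \<in> borel_measurable M" unfolding v_def using p_measurable by measurable
    show "AE x in M. v x \<in> {a 1..a d}"
      unfolding v_def using bang_mem[OF \<alpha>_pos] by (intro AE_I2)
  qed
  note [simp] = near_switch_sets integrable_abs_diff[OF u] integrable_h[OF u] integrable_h[OF v]
    integrable_h[OF ubar_admissible]
  \<comment> \<open>Comparing both \<open>u\<close> and \<open>ubar\<close> with the pointwise
    minimiser \<open>v\<close> avoids identifying \<open>ubar\<close> with \<open>v\<close>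
    beforehand. The two differences of \<open>h\<close> integrate to
    \<open>gap u - 2 * gap v\<close>, where \<open>gap v \<ge> 0\<close>.\<close>
  have "(LINT x|M. e * \<bar>u x - ubar x\<bar>)
      \<le> (LINT x|M. (h x (u x) - h x (v x)) + (h x (ubar x) - h x (v x))
          + e * (a d - a 1) * indicator (near_switch e) x)"
  proof (rule integral_mono_AE)
    show "AE x in M. e * \<bar>u x - ubar x\<bar> \<le> (h x (u x) - h x (v x)) + (h x (ubar x) - h x (v x))
          + e * (a d - a 1) * indicator (near_switch e) x"
      using admissible_AE[OF u] admissible_AE[OF ubar_admissible] AE_space
    proof eventually_elim
      case (elim x)
      have growth: "c * \<bar>s - v x\<bar> \<le> h x s - h x (v x)"
        if "s \<in> {a 1..a d}" "\<And>i. 1 \<le> i \<Longrightarrow> i < d \<Longrightarrow> c \<le> \<bar>p x - \<alpha>/2 * (a i + a (i + 1))\<bar>" for s c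
        using bang_growth[OF \<alpha>_pos that] by (simp add: h_def v_def algebra_simps)
      show ?case
      proof (cases "x \<in> near_switch e")
        \<comment> \<open>Near a switching value growth is available only with slope 0, so both
          \<open>h\<close> differences are merely nonnegative. The indicator term pays for the
          left-hand side, as \<open>u\<close> and \<open>ubar\<close> differ by at most
          \<open>a d - a 1\<close>.\<close>
        case True
        have "e * \<bar>u x - ubar x\<bar> \<le> e * (a d - a 1)"
          using elim e by (intro mult_left_mono) auto
        then show ?thesis
          using True growth[of "u x" 0] growth[of "ubar x" 0] elim by simp
      next
        case False
        then have far: "e \<le> \<bar>p x - \<alpha>/2 * (a i + a (i + 1))\<bar>" if "1 \<le> i" "i < d" for i
          using elim that by (force simp: near_switch_def not_less)
        have "e * \<bar>u x - ubar x\<bar> \<le> e * (\<bar>u x - v x\<bar> + \<bar>ubar x - v x\<bar>)"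
          using e by (intro mult_left_mono) auto
        then show ?thesis
          using False growth[OF _ far, of "u x"] growth[OF _ far, of "ubar x"] elim
          by (simp add: distrib_left)
      qed
    qed
  qed (auto intro!: Bochner_Integration.integrable_add Bochner_Integration.integrable_diff
      simp: fin.emeasure_finite less_top[symmetric])
  also have "\<dots> = gap u - 2 * gap v + e * (a d - a 1) * measure M (near_switch e)"
    using sets.sets_into_space[OF near_switch_sets, of e]
    by (simp add: gap_def Int_absorb2 fin.emeasure_finite less_top[symmetric])
  finally show ?thesis
    using gap_nonneg[OF v] by (simp add: L1_norm_def measure_near_switch)
qed

text \<open>The estimate is needed at \<open>e\<close> proportional to an arbitrary
  \<open>\<gamma>\<close>, but the assumption covers small \<open>e\<close> only. For
  \<open>e \<ge> b\<close> the total measure of \<open>\<Omega>\<close> is a bound, and dividing it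
  by \<open>b powr \<kappa>\<close> gives the extra constant \<open>m\<close>.\<close>

lemma REG_global:
  assumes "REG \<Omega> \<alpha> d a p \<kappa>"
  obtains c where "c > 0" "\<And>e. e > 0 \<Longrightarrow> measure lebesgue (near_switch e) \<le> c * e powr \<kappa>"
proof -
  from assms obtain c where c: "c > 0" and \<kappa>: "\<kappa> > 0"
    and ev: "\<forall>\<^sub>F e in at_right 0. measure lebesgue (near_switch e) \<le> c * e powr \<kappa>"
    unfolding REG_def near_switch_def by blast
  from ev obtain b where b: "b > 0"
    and small: "\<And>e. 0 < e \<Longrightarrow> e < b \<Longrightarrow> measure lebesgue (near_switch e) \<le> c * e powr \<kappa>"
    unfolding eventually_at_right_field by auto
  define m where "m = measure M (space M) / b powr \<kappa>"
  have m: "m \<ge> 0" by (simp add: m_def)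
  show ?thesis
  proof
    show "c + m > 0" using c m by simp
    fix e :: real assume e: "e > 0"
    show "measure lebesgue (near_switch e) \<le> (c + m) * e powr \<kappa>"
    proof (cases "e < b")
      case True
      have "c * e powr \<kappa> \<le> (c + m) * e powr \<kappa>" using m by (intro mult_right_mono) auto
      with small[OF e True] show ?thesis by linarith
    next
      case False
      have "measure lebesgue (near_switch e) \<le> measure M (space M)"
        using fin.bounded_measure by (simp add: measure_near_switch[symmetric])
      also have "\<dots> = m * b powr \<kappa>" using b by (simp add: m_def)
      also have "\<dots> \<le> (c + m) * e powr \<kappa>"
        using False b c m \<kappa> by (intro mult_mono powr_mono2) auto
      finally show ?thesis .
    qed
  qed
qed

section \<open>Comparison with the regularised problem and the convergence rate\<close>

lemma regularised_bound:
  assumes \<gamma>: "\<gamma> > 0" and sol: "solution_P_reg \<Omega> K z \<alpha> d a \<gamma> u"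
    and A: "\<And>v. v \<in> {a 1..a d} \<Longrightarrow> \<bar>v\<bar> \<le> A"
  shows "u \<in> admissible \<Omega> d a"
    and "1/2 * (norm (K u - K ubar))\<^sup>2 + gap u + \<gamma>/2 * (L2_norm \<Omega> (\<lambda>x. u x - ubar x))\<^sup>2
      \<le> \<gamma> * A * L1_norm \<Omega> (\<lambda>x. u x - ubar x)"
proof -
  show u: "u \<in> admissible \<Omega> d a"
    using sol by (simp add: solution_P_reg_def is_arg_min_def)
  note L2 = admissible_L2[OF u] admissible_L2[OF ubar_admissible]
  have sq: "(L2_norm \<Omega> w)\<^sup>2 = (LINT x|M. (w x)\<^sup>2)" for w :: "real^'n \<Rightarrow> real"
    by (simp add: L2_norm_def)
  have int_sq: "integrable M (\<lambda>x. (w x)\<^sup>2)" if "w \<in> L2_space \<Omega>" for w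
    using that by (simp add: L2_space_def)
  have "J u + \<gamma>/2 * (L2_norm \<Omega> u)\<^sup>2 \<le> J ubar + \<gamma>/2 * (L2_norm \<Omega> ubar)\<^sup>2"
    using sol u ubar_admissible
    by (auto simp: solution_P_reg_def is_arg_min_def objective_reg_def objective_eq not_less)
  then have "1/2 * (norm (K u - K ubar))\<^sup>2 + gap u
      \<le> \<gamma>/2 * ((L2_norm \<Omega> ubar)\<^sup>2 - (L2_norm \<Omega> u)\<^sup>2)"
    using J_expansion[OF u] by (simp add: algebra_simps)
  \<comment> \<open>Pointwise, \<open>(ubar x)\<^sup>2 - (u x)\<^sup>2\<close> equals
    \<open>- 2 * ubar x * (u x - ubar x) - (u x - ubar x)\<^sup>2\<close>. The first term is
    controlled by the bound \<open>A\<close> on \<open>ubar\<close>; the second supplies the squared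
    distance in the conclusion.\<close>
  moreover have "(L2_norm \<Omega> ubar)\<^sup>2 - (L2_norm \<Omega> u)\<^sup>2
      \<le> 2 * A * L1_norm \<Omega> (\<lambda>x. u x - ubar x) - (L2_norm \<Omega> (\<lambda>x. u x - ubar x))\<^sup>2"
  proof -
    have "(LINT x|M. (ubar x)\<^sup>2 - (u x)\<^sup>2)
        \<le> (LINT x|M. 2 * A * \<bar>u x - ubar x\<bar> - (u x - ubar x)\<^sup>2)"
    proof (rule integral_mono_AE)
      show "AE x in M. (ubar x)\<^sup>2 - (u x)\<^sup>2 \<le> 2 * A * \<bar>u x - ubar x\<bar> - (u x - ubar x)\<^sup>2"
        using admissible_AE[OF ubar_admissible]
      proof eventually_elim
        case (elim x)
        have "- (ubar x * (u x - ubar x)) \<le> \<bar>ubar x\<bar> * \<bar>u x - ubar x\<bar>"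
          by (metis abs_ge_minus_self abs_mult)
        also have "\<dots> \<le> A * \<bar>u x - ubar x\<bar>"
          using A[OF elim] by (intro mult_right_mono) auto
        finally show ?case by (simp add: power2_eq_square algebra_simps)
      qed
    qed (use integrable_abs_diff[OF u] int_sq L2 L2_diff[OF L2] in auto)
    then show ?thesis
      using integrable_abs_diff[OF u] int_sq[OF L2(1)] int_sq[OF L2(2)] int_sq[OF L2_diff[OF L2]]
      by (simp add: sq L1_norm_def)
  qed
  then have "\<gamma>/2 * ((L2_norm \<Omega> ubar)\<^sup>2 - (L2_norm \<Omega> u)\<^sup>2) \<le>
      \<gamma>/2 * (2 * A * L1_norm \<Omega> (\<lambda>x. u x - ubar x) - (L2_norm \<Omega> (\<lambda>x. u x - ubar x))\<^sup>2)"
    using \<gamma> by (intro mult_left_mono) auto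
  ultimately show "1/2 * (norm (K u - K ubar))\<^sup>2 + gap u
      + \<gamma>/2 * (L2_norm \<Omega> (\<lambda>x. u x - ubar x))\<^sup>2 \<le> \<gamma> * A * L1_norm \<Omega> (\<lambda>x. u x - ubar x)"
    by (simp add: algebra_simps)
qed

theorem convergence_rate:
  assumes reg: "REG \<Omega> \<alpha> d a p \<kappa>"
  shows "\<exists>c>0. \<forall>\<gamma>>0. \<forall>u. solution_P_reg \<Omega> K z \<alpha> d a \<gamma> u \<longrightarrow>
      1/\<gamma> * (norm (K u - K ubar))\<^sup>2 + 1/\<gamma> * L1_norm \<Omega> (\<lambda>x. u x - ubar x) powr (1 + 1/\<kappa>)
      + (L2_norm \<Omega> (\<lambda>x. u x - ubar x))\<^sup>2 \<le> c * \<gamma> powr \<kappa>"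
proof -
  obtain c0 where c0: "c0 > 0"
    and meas: "\<And>e. e > 0 \<Longrightarrow> measure lebesgue (near_switch e) \<le> c0 * e powr \<kappa>"
    using REG_global[OF reg] by blast
  have \<kappa>: "\<kappa> > 0" using reg by (simp add: REG_def)
  define A where "A = \<bar>a 1\<bar> + \<bar>a d\<bar> + 1"
  define D where "D = a d - a 1"
  \<comment> \<open>\<open>C * \<gamma> * \<gamma> powr \<kappa>\<close> is the switching-set term
    \<open>e * D * (c0 * e powr \<kappa>)\<close> at \<open>e = 2 * A * \<gamma>\<close>.\<close>
  define C where "C = 2 * A * D * c0 * (2 * A) powr \<kappa>"
  have A_bound: "\<And>v. v \<in> {a 1..a d} \<Longrightarrow> \<bar>v\<bar> \<le> A"
    using levels_abs_le unfolding A_def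
    by (meson add_increasing2 order_trans zero_le_one order_refl add_mono)
  have A: "A > 0" by (simp add: A_def)
  have D: "D > 0" using level_less[of 1 d] d_ge_2 by (simp add: D_def)
  have C: "C > 0" using A D c0 by (simp add: C_def)
  show ?thesis
  \<comment> \<open>The state term and the squared norm contribute \<open>2 * C\<close> each, the
    power of the first norm contributes the rest.\<close>
  proof (intro exI[of _ "4 * C + (C / A) powr (1 + 1/\<kappa>)"] conjI allI impI)
    show "0 < 4 * C + (C / A) powr (1 + 1/\<kappa>)" using C by (simp add: add_pos_nonneg)
    fix \<gamma> :: real and u assume \<gamma>: "\<gamma> > 0" and sol: "solution_P_reg \<Omega> K z \<alpha> d a \<gamma> u"
    define L where "L = L1_norm \<Omega> (\<lambda>x. u x - ubar x)"
    define W where "W = (L2_norm \<Omega> (\<lambda>x. u x - ubar x))\<^sup>2"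
    define Y where "Y = (norm (K u - K ubar))\<^sup>2"
    define G where "G = \<gamma> powr \<kappa>"
    have nonneg: "L \<ge> 0" "W \<ge> 0" "Y \<ge> 0" by (auto simp: L_def W_def Y_def L1_norm_def)
    have "1/2 * Y + gap u + \<gamma>/2 * W \<le> \<gamma> * A * L" and u: "u \<in> admissible \<Omega> d a"
      using regularised_bound[OF \<gamma> sol A_bound] by (simp_all add: L_def W_def Y_def)
    \<comment> \<open>The choice \<open>e = 2 * A * \<gamma>\<close> doubles the coefficient of
      \<open>L\<close> in \<open>regularised_bound\<close>: adding the two estimates cancels
      \<open>gap u\<close> and leaves \<open>\<gamma> * A * L\<close> on the left.\<close>
    moreover have "2 * A * \<gamma> * L \<le> gap u + C * \<gamma> * G"
    proof -
      have "2 * A * \<gamma> * D * measure lebesgue (near_switch (2 * A * \<gamma>))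
          \<le> 2 * A * \<gamma> * D * (c0 * (2 * A * \<gamma>) powr \<kappa>)"
        using A D \<gamma> by (intro mult_left_mono meas) auto
      moreover have "\<dots> = C * \<gamma> * G"
        using A \<gamma> by (simp add: C_def G_def powr_mult)
      moreover have "2 * A * \<gamma> * L
          \<le> gap u + 2 * A * \<gamma> * D * measure lebesgue (near_switch (2 * A * \<gamma>))"
        using gap_growth[OF u, of "2 * A * \<gamma>"] A \<gamma> by (simp add: L_def D_def)
      ultimately show ?thesis by linarith
    qed
    ultimately have "1/2 * Y + \<gamma>/2 * W + \<gamma> * A * L \<le> C * \<gamma> * G"
      by (simp add: mult.commute mult.left_commute)
    then have "(1/2 * Y + \<gamma>/2 * W + \<gamma> * A * L) / \<gamma> \<le> C * G"
      using \<gamma> by (simp add: pos_divide_le_eq mult_ac)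
    then have sum_le: "1/2 * (Y / \<gamma>) + 1/2 * W + A * L \<le> C * G"
      using \<gamma> by (simp add: add_divide_distrib)
    moreover have "A * L \<ge> 0" "Y / \<gamma> \<ge> 0" using A \<gamma> nonneg by auto
    ultimately have Y: "Y / \<gamma> \<le> 2 * (C * G)" and W: "W \<le> 2 * (C * G)" and "A * L \<le> C * G"
      using nonneg by linarith+
    then have "L \<le> C / A * G" using A by (simp add: field_simps)
    then have "L powr (1 + 1/\<kappa>) \<le> (C / A * G) powr (1 + 1/\<kappa>)"
      using nonneg \<kappa> by (intro powr_mono2) auto
    also have "\<dots> = (C / A) powr (1 + 1/\<kappa>) * (\<gamma> * G)"
    proof -
      \<comment> \<open>The exponent is matched to the rate:
        \<open>\<kappa> * (1 + 1/\<kappa>) = \<kappa> + 1\<close>, so one extra factor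
        \<open>\<gamma>\<close> appears and cancels the weight \<open>1/\<gamma>\<close>.\<close>
      have "G powr (1 + 1/\<kappa>) = \<gamma> powr (\<kappa> + 1)"
        using \<kappa> by (simp add: G_def powr_powr distrib_left)
      then have "G powr (1 + 1/\<kappa>) = \<gamma> * G"
        using \<gamma> by (simp add: powr_add G_def)
      moreover have "(C / A * G) powr (1 + 1/\<kappa>) = (C / A) powr (1 + 1/\<kappa>) * G powr (1 + 1/\<kappa>)"
        by (rule powr_mult)
      ultimately show ?thesis by simp
    qed
    finally have "L powr (1 + 1/\<kappa>) / \<gamma> \<le> (C / A) powr (1 + 1/\<kappa>) * G"
      using \<gamma> by (simp add: pos_divide_le_eq mult_ac)
    with Y W show "1/\<gamma> * (norm (K u - K ubar))\<^sup>2
        + 1/\<gamma> * L1_norm \<Omega> (\<lambda>x. u x - ubar x) powr (1 + 1/\<kappa>)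
        + (L2_norm \<Omega> (\<lambda>x. u x - ubar x))\<^sup>2
        \<le> (4 * C + (C / A) powr (1 + 1/\<kappa>)) * \<gamma> powr \<kappa>"
      by (simp add: L_def W_def Y_def G_def distrib_right)
  qed
qed

end

theorem theorem3p4:
  fixes \<Omega> :: "(real^'n) set"
    and K :: "(real^'n \<Rightarrow> real) \<Rightarrow> 'y::{real_inner, complete_space}"
    and Kstar :: "'y \<Rightarrow> real^'n \<Rightarrow> real"
    and z :: 'y
    and \<alpha> \<kappa> :: real
    and d :: nat
    and a :: "nat \<Rightarrow> real"
    and ubar :: "real^'n \<Rightarrow> real"
  assumes "open \<Omega>" and "connected \<Omega>" and "\<Omega> \<noteq> {}" and "bounded \<Omega>"
    and "bounded_linear_L2 \<Omega> K"
    and "is_adjoint_L2 \<Omega> K Kstar"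
    and "\<alpha> > 0"
    and "d \<ge> 2"
    and "strict_mono_on {1..d} a"
    and "solution_P \<Omega> K z \<alpha> d a ubar"
    and "REG \<Omega> \<alpha> d a (Kstar (z - K ubar)) \<kappa>"
  shows "\<exists>c>0. \<forall>\<gamma>>0. \<forall>u\<^sub>\<gamma>. solution_P_reg \<Omega> K z \<alpha> d a \<gamma> u\<^sub>\<gamma> \<longrightarrow>
           1/\<gamma> * (norm (K u\<^sub>\<gamma> - K ubar))\<^sup>2
         + 1/\<gamma> * L1_norm \<Omega> (\<lambda>x. u\<^sub>\<gamma> x - ubar x) powr (1 + 1/\<kappa>)
         + (L2_norm \<Omega> (\<lambda>x. u\<^sub>\<gamma> x - ubar x))\<^sup>2 \<le> c * \<gamma> powr \<kappa>"
proof -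
  interpret multibang_control d a \<Omega> K Kstar z \<alpha> ubar
    using assms by unfold_locales (auto intro: lmeasurable_open)
  show ?thesis using assms(11) by (rule convergence_rate)
qed

end
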